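(* Let $\hat v\in\mathbb{C}^N$ and $\hat s\in\mathbb{C}^N$ be such that the pair $(\hat v,\hat s)$ is a solution of the load-flow equation, i.e. all $\hat v_j\neq 0$ and $$\hat v = w + Y_{LL}^{-1}\,\mathrm{diag}(\overline{\hat v})^{-1}\,\overline{\hat s}.$$ Let $s\in\mathbb{C}^N$ be another complex power injection vector. Put $u_{min} = \min_{j}|\hat v_j/w_j|$. Assume that $$\xi(\hat s) < u_{min}^2 \qquad\text{and}\qquad \Delta := \left(u_{min}-\frac{\xi(\hat s)}{u_{min}}\right)^2-4\,\xi(s-\hat s) > 0 .$$ Let $$\rho := \frac{\left(u_{min}-\frac{\xi(\hat s)}{u_{min}}\right)-\sqrt{\Delta}}{2},\qquad \mathcal{D} := \{v\in\mathbb{C}^N:\ |v_i-\hat v_i|\le \rho\,|w_i| \text{ for all } i=1,\dots,N\}.$$ Then there exists a unique $v\in\mathcal{D}$ such that $(v,s)$ is a solution of the load-flow equation, i.e. $$v = w + Y_{LL}^{-1}\,\mathrm{diag}(\overline{v})^{-1}\,\overline{s}.$$ Moreover, for every starting point $v^{(0)}\in\mathcal{D}$, the iteration $$v^{(k+1)} = w + Y_{LL}^{-1}\,\mathrm{diag}(\overline{v^{(k)}})^{-1}\,\overline{s}$$ converges to this solution $v$.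
   Context: Consider a network with one slack bus (index $0$, with complex voltage fixed to $1$) and $N$ $PQ$ buses (indices $1,\dots,N$). Its nodal admittance matrix is a complex $(N+1)\times(N+1)$ matrix partitioned as $$Y=\begin{bmatrix} Y_{00} & Y_{0L}\\ Y_{L0} & Y_{LL}\end{bmatrix},$$ with $Y_{00}$ a scalar, $Y_{0L}$ a $1\times N$ row, $Y_{L0}$ an $N\times 1$ column and $Y_{LL}$ an $N\times N$ matrix. Standing assumptions: $Y_{LL}$ is invertible, and the zero-load voltage $w := -Y_{LL}^{-1}Y_{L0}\in\mathbb{C}^N$ has all entries nonzero. Put $W := \mathrm{diag}(w)$. Bars denote (entrywise) complex conjugation. For $s\in\mathbb{C}^N$ define $$\xi(s) := \left\| W^{-1}Y_{LL}^{-1}\overline{W}^{-1}\mathrm{diag}(\overline{s})\right\|_\infty,$$ where for a complex matrix $A$, $\|A\|_\infty := \max_i\sum_j|A_{ij}|$. The load-flow equation for nodal voltages $v\in\mathbb{C}^N$ (with all $v_j\ne 0$) and nodal power injections $s\in\mathbb{C}^N$ is $v = w + Y_{LL}^{-1}\mathrm{diag}(\overline{v})^{-1}\overline{s}$. *)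

theory Defs
  imports "HOL-Analysis.Analysis"
begin

(* Buses are indexed by 'n option: None is the slack bus, Some j (j :: 'n) are the N = CARD('n) PQ buses. *)

definition Y_LL :: "complex ^ ('n::finite) option ^ 'n option \<Rightarrow> complex ^ 'n ^ 'n" where
  "Y_LL Y = (\<chi> i j. Y $ Some i $ Some j)"

definition Y_L0 :: "complex ^ ('n::finite) option ^ 'n option \<Rightarrow> complex ^ 'n" where
  "Y_L0 Y = (\<chi> i. Y $ Some i $ None)"

definition diag_mat :: "complex ^ 'n \<Rightarrow> complex ^ 'n ^ 'n" where
  "diag_mat x = (\<chi> i j. if i = j then x $ i else 0)"

definition cnj_vec :: "complex ^ 'n \<Rightarrow> complex ^ 'n" where
  "cnj_vec x = (\<chi> i. cnj (x $ i))"

definition cnj_mat :: "complex ^ 'n ^ 'm \<Rightarrow> complex ^ 'n ^ 'm" where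
  "cnj_mat A = (\<chi> i j. cnj (A $ i $ j))"

definition mat_norm_inf :: "complex ^ 'n ^ 'm \<Rightarrow> real" where
  "mat_norm_inf A = (MAX i. \<Sum>j\<in>UNIV. cmod (A $ i $ j))"

definition zero_load_voltage :: "complex ^ ('n::finite) option ^ 'n option \<Rightarrow> complex ^ 'n" where
  "zero_load_voltage Y = - (matrix_inv (Y_LL Y) *v Y_L0 Y)"

definition lf_xi :: "complex ^ ('n::finite) option ^ 'n option \<Rightarrow> complex ^ 'n \<Rightarrow> real" where
  "lf_xi Y s = (let W = diag_mat (zero_load_voltage Y) in
     mat_norm_inf (matrix_inv W ** matrix_inv (Y_LL Y) ** matrix_inv (cnj_mat W)
       ** diag_mat (cnj_vec s)))"

(* matrix_inv is unspecified on singular matrices, so lf_step is only meaningful when all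
   entries of v are nonzero. *)
definition lf_step ::
    "complex ^ ('n::finite) option ^ 'n option \<Rightarrow> complex ^ 'n \<Rightarrow> complex ^ 'n \<Rightarrow> complex ^ 'n" where
  "lf_step Y s v = zero_load_voltage Y
     + matrix_inv (Y_LL Y) *v (matrix_inv (diag_mat (cnj_vec v)) *v cnj_vec s)"

definition lf_solution ::
    "complex ^ ('n::finite) option ^ 'n option \<Rightarrow> complex ^ 'n \<Rightarrow> complex ^ 'n \<Rightarrow> bool" where
  "lf_solution Y v s \<longleftrightarrow> (\<forall>j. v $ j \<noteq> 0) \<and> v = lf_step Y s v"

end

theory Submission
  imports Defs
begin

text \<open>In the norm \<open>max\<^sub>i |v\<^sub>i| / |w\<^sub>i|\<close>, every point of \<open>D\<close> satisfies
  \<open>|v\<^sub>i| \<ge> (u_min - \<rho>) |w\<^sub>i|\<close>. Comparing the load-flow map for \<open>s\<close> at \<open>v\<close> with the one for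
  \<open>s_hat\<close> at its fixed point \<open>v_hat\<close> shows that \<open>D\<close> is mapped into itself as soon as
  \<open>\<rho>\<^sup>2 - a \<rho> + \<xi>(s - s_hat) \<le> 0\<close> with \<open>a = u_min - \<xi>(s_hat) / u_min\<close>; \<open>\<rho>\<close> is the smaller
  root of this quadratic. On \<open>D\<close> the map has Lipschitz constant
  \<open>(\<xi>(s_hat) + \<xi>(s - s_hat)) / (u_min - \<rho>)\<^sup>2\<close>, and the numerator falls short of the
  denominator by \<open>(u_min - \<rho>) (a - 2 \<rho>) > 0\<close>, so Banach's theorem applies.\<close>

subsection \<open>Contractions in a weighted maximum norm\<close>

lemma norm_vec_le_sum:
  fixes x :: "'a::real_normed_vector ^ 'n"
  shows "norm x \<le> (\<Sum>i\<in>UNIV. norm (x $ i))"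
  unfolding norm_vec_def by (rule L2_set_le_sum) simp

text \<open>A sufficiently high power of a contraction in the weighted maximum norm contracts the
  Euclidean norm, in which the library's fixed point theorem is stated.\<close>

lemma weighted_max_contraction:
  fixes f :: "'a::banach ^ 'n \<Rightarrow> 'a ^ 'n" and c :: "'n \<Rightarrow> real"
  assumes D: "closed D" "D \<noteq> {}" and self: "\<And>x. x \<in> D \<Longrightarrow> f x \<in> D"
    and c: "\<And>i. c i > 0" and q: "0 \<le> q" "q < 1"
    and contr: "\<And>x y r i. x \<in> D \<Longrightarrow> y \<in> D \<Longrightarrow> (\<And>j. norm (x $ j - y $ j) \<le> r * c j)
                  \<Longrightarrow> norm (f x $ i - f y $ i) \<le> q * r * c i"
  shows "\<exists>!x. x \<in> D \<and> f x = x"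
    and "x \<in> D \<Longrightarrow> f x = x \<Longrightarrow> y \<in> D \<Longrightarrow> (\<lambda>k. (f ^^ k) y) \<longlonglongrightarrow> x"
proof -
  have pow_self: "(f ^^ k) x \<in> D" if "x \<in> D" for k x
    using that by (induction k) (auto intro: self)
  have pow: "norm ((f ^^ k) x $ i - (f ^^ k) y $ i) \<le> q ^ k * r * c i"
    if xy: "x \<in> D" "y \<in> D" and r: "\<And>j. norm (x $ j - y $ j) \<le> r * c j" for k x y r i
  proof (induction k arbitrary: i)
    case 0
    show ?case using r by simp
  next
    case (Suc k)
    show ?case
      using contr[OF pow_self[OF xy(1)] pow_self[OF xy(2)] Suc] by (simp add: mult.assoc)
  qed
  \<comment> \<open>The smallest weight turns a Euclidean distance into a weighted radius:
    \<open>norm (x - y) / m\<close> is an admissible \<open>r\<close> in \<open>pow\<close>.\<close>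
  define m where "m = Min (range c)"
  have m: "m > 0" "m \<le> c i" for i
    using c by (auto simp: m_def)
  have start: "norm (x $ j - y $ j) \<le> norm (x - y) / m * c j" for x y :: "'a ^ 'n" and j
  proof -
    have "norm (x $ j - y $ j) \<le> norm (x - y)"
      by (metis Finite_Cartesian_Product.norm_nth_le vector_minus_component)
    also have "\<dots> = norm (x - y) / m * m" using m(1) by simp
    also have "\<dots> \<le> norm (x - y) / m * c j"
      using m by (intro mult_left_mono) (auto intro: less_imp_le)
    finally show ?thesis .
  qed
  \<comment> \<open>The loss in passing from the Euclidean norm to the weighted one and back. It
    does not depend on \<open>k\<close>, so \<open>q ^ k\<close> eventually outweighs it.\<close>
  define K where "K = sum c UNIV / m"
  have eucl: "dist ((f ^^ k) x) ((f ^^ k) y) \<le> (q ^ k * K) * dist x y"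
    if "x \<in> D" "y \<in> D" for k x y
  proof -
    have "dist ((f ^^ k) x) ((f ^^ k) y) \<le> (\<Sum>i\<in>UNIV. norm ((f ^^ k) x $ i - (f ^^ k) y $ i))"
      using norm_vec_le_sum[of "(f ^^ k) x - (f ^^ k) y"] by (simp add: dist_norm)
    also have "\<dots> \<le> (\<Sum>i\<in>UNIV. q ^ k * (norm (x - y) / m) * c i)"
      by (intro sum_mono pow that start)
    also have "\<dots> = (q ^ k * K) * dist x y"
      by (simp add: K_def dist_norm sum_distrib_left sum_distrib_right sum_divide_distrib mult_ac)
    finally show ?thesis .
  qed
  have "K \<ge> 0"
    unfolding K_def using m(1) c by (intro divide_nonneg_pos sum_nonneg) (auto intro: less_imp_le)
  have lim0: "(\<lambda>k. q ^ k * A) \<longlonglongrightarrow> 0" for A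
    using tendsto_mult_right[OF LIMSEQ_realpow_zero[OF q], of A] by (simp add: mult.commute)
  have ev: "\<forall>\<^sub>F k in sequentially. q ^ k * K < 1"
    by (rule order_tendstoD(2)[OF lim0]) simp
  then obtain k where k: "q ^ k * K < 1"
    by (meson eventually_happens sequentially_bot)
  have "\<exists>!x\<in>D. (f ^^ k) x = x"
  proof (rule Banach_fix)
    show "complete D" using D(1) by (simp add: complete_eq_closed)
    show "0 \<le> q ^ k * K" using \<open>K \<ge> 0\<close> q by simp
  qed (use D k pow_self eucl in auto)
  then obtain z where z: "z \<in> D" "(f ^^ k) z = z"
    and uniq: "\<And>y. y \<in> D \<Longrightarrow> (f ^^ k) y = y \<Longrightarrow> y = z" by blast
  \<comment> \<open>\<open>f\<close> commutes with its own power, so \<open>f z\<close> is another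
    fixed point of \<open>f ^^ k\<close> in \<open>D\<close>; uniqueness makes it
    \<open>z\<close>.\<close>
  have "(f ^^ k) (f z) = f z"
    using z(2) by (metis funpow_swap1)
  with uniq self z(1) have fz: "f z = z" by blast
  have fix_pow: "(f ^^ j) x = x" if "f x = x" for x j
    using that by (induction j) auto
  show "\<exists>!x. x \<in> D \<and> f x = x"
    using z(1) fz uniq fix_pow by blast
  show "(\<lambda>k. (f ^^ k) y) \<longlonglongrightarrow> x" if "x \<in> D" "f x = x" "y \<in> D"
  proof -
    \<comment> \<open>Every power of \<open>f\<close> fixes \<open>x\<close>, so \<open>eucl\<close>
      measures the distance of the iterates to \<open>x\<close> itself, along the whole
      sequence.\<close>
    have "(\<lambda>k. dist ((f ^^ k) y) x) \<longlonglongrightarrow> 0"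
    proof (rule tendsto_sandwich)
      show "\<forall>\<^sub>F k in sequentially. dist ((f ^^ k) y) x \<le> q ^ k * (K * dist y x)"
        using eucl[OF that(3,1)] fix_pow[OF that(2)] by (simp add: mult.assoc)
      show "\<forall>\<^sub>F k in sequentially. 0 \<le> dist ((f ^^ k) y) x" by simp
    qed (rule lim0 tendsto_const)+
    then show ?thesis by (rule tendsto_dist_iff[THEN iffD2])
  qed
qed

subsection \<open>The load-flow map in coordinates\<close>

text \<open>For square matrices a right inverse is two-sided, so the choice in
  \<open>matrix_inv\<close> has a witness; associativity then identifies it with
  \<open>B\<close>.\<close>

lemma matrix_inv_unique:
  fixes A :: "'a::field ^ 'n ^ 'n"
  assumes "A ** B = mat 1"
  shows "matrix_inv A = B"
proof -
  have BA: "B ** A = mat 1"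
    using assms by (simp add: matrix_left_right_inverse)
  then have "matrix_inv A ** A = mat 1"
    using assms unfolding matrix_inv_def by (metis (mono_tags, lifting) someI_ex)
  then show ?thesis
    by (metis assms matrix_mul_assoc matrix_mul_lid matrix_mul_rid)
qed

lemma diag_mat_nth: "diag_mat x $ i $ j = (if i = j then x $ i else 0)"
  by (simp add: diag_mat_def)

lemma matrix_mul_diag_mat: "(A ** diag_mat x) $ i $ j = A $ i $ j * x $ j"
  by (simp add: matrix_matrix_mult_def diag_mat_def if_distrib cong: if_cong)

lemma diag_mat_matrix_mul: "(diag_mat x ** A) $ i $ j = x $ i * A $ i $ j"
  by (simp add: matrix_matrix_mult_def diag_mat_def if_distrib[of "\<lambda>a. a * _"] cong: if_cong)

lemma diag_mat_vector_mul: "(diag_mat x *v y) $ i = x $ i * y $ i"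
  by (simp add: matrix_vector_mult_def diag_mat_def if_distrib[of "\<lambda>a. a * _"] cong: if_cong)

lemma matrix_inv_diag_mat:
  assumes "\<And>j. x $ j \<noteq> 0"
  shows "matrix_inv (diag_mat x) = diag_mat (\<chi> j. inverse (x $ j))"
  by (rule matrix_inv_unique)
    (use assms in \<open>auto simp: vec_eq_iff diag_mat_matrix_mul mat_def diag_mat_nth\<close>)

lemma cnj_mat_diag_mat: "cnj_mat (diag_mat x) = diag_mat (cnj_vec x)"
  by (simp add: vec_eq_iff cnj_mat_def diag_mat_def cnj_vec_def)

lemma lf_step_nth:
  assumes "\<And>j. v $ j \<noteq> 0"
  shows "lf_step Y s v $ i = zero_load_voltage Y $ i
    + (\<Sum>j\<in>UNIV. matrix_inv (Y_LL Y) $ i $ j * (cnj (s $ j) * inverse (cnj (v $ j))))"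
proof -
  have "matrix_inv (diag_mat (cnj_vec v)) = diag_mat (\<chi> j. inverse (cnj (v $ j)))"
    using matrix_inv_diag_mat[of "cnj_vec v"] assms by (simp add: cnj_vec_def)
  then show ?thesis
    unfolding lf_step_def
    by (simp add: matrix_vector_mult_def[of "matrix_inv (Y_LL Y)"] diag_mat_vector_mul
        cnj_vec_def mult_ac)
qed

section \<open>Row-sum estimates by \<open>lf_xi\<close>\<close>

lemma row_sum_le_mat_norm_inf: "(\<Sum>j\<in>UNIV. cmod (A $ i $ j)) \<le> mat_norm_inf A"
  unfolding mat_norm_inf_def by (rule Max_ge) auto

lemma mat_norm_inf_nonneg: "0 \<le> mat_norm_inf A"
  \<comment> \<open>\<open>undefined\<close> serves as an arbitrary row; index types are
    nonempty.\<close>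
  using row_sum_le_mat_norm_inf[of A undefined] by (meson order_trans sum_nonneg norm_ge_zero)

lemma lf_xi_nonneg: "0 \<le> lf_xi Y s"
  by (simp add: lf_xi_def Let_def mat_norm_inf_nonneg)

text \<open>Both diagonal inverses act entrywise, so entry \<open>(i, j)\<close> of the matrix in
  \<open>lf_xi\<close> carries the factors \<open>1 / w $ i\<close> and
  \<open>1 / cnj (w $ j)\<close>. Multiplying by \<open>cmod (w $ i)\<close> clears the
  first.\<close>

lemma row_sum_le_lf_xi:
  fixes Y :: "complex ^ ('n::finite) option ^ 'n option"
  defines "w \<equiv> zero_load_voltage Y"
  assumes w: "\<And>j. w $ j \<noteq> 0"
  shows "(\<Sum>j\<in>UNIV. cmod (matrix_inv (Y_LL Y) $ i $ j) * cmod (s $ j) / cmod (w $ j))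
    \<le> lf_xi Y s * cmod (w $ i)"
proof -
  let ?A = "matrix_inv (diag_mat w) ** matrix_inv (Y_LL Y)
    ** matrix_inv (cnj_mat (diag_mat w)) ** diag_mat (cnj_vec s)"
  have inv: "matrix_inv (diag_mat w) = diag_mat (\<chi> j. inverse (w $ j))"
    "matrix_inv (cnj_mat (diag_mat w)) = diag_mat (\<chi> j. inverse (cnj (w $ j)))"
    using matrix_inv_diag_mat[of w] matrix_inv_diag_mat[of "cnj_vec w"] w
    by (simp_all add: cnj_mat_diag_mat cnj_vec_def)
  have "(\<Sum>j\<in>UNIV. cmod (matrix_inv (Y_LL Y) $ i $ j) * cmod (s $ j) / cmod (w $ j))
      = (\<Sum>j\<in>UNIV. cmod (?A $ i $ j)) * cmod (w $ i)"
    unfolding inv matrix_mul_diag_mat diag_mat_matrix_mul sum_distrib_right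
    by (rule sum.cong) (use w in \<open>auto simp: norm_mult norm_inverse cnj_vec_def divide_inverse\<close>)
  also have "\<dots> \<le> lf_xi Y s * cmod (w $ i)"
    using row_sum_le_mat_norm_inf[of ?A i]
    by (simp add: lf_xi_def Let_def w_def mult_right_mono)
  finally show ?thesis .
qed

text \<open>Here \<open>b\<close> stands for reciprocals of conjugate voltages or differences of
  such. Their size relative to \<open>1 / cmod (w $ j)\<close> matches the column scaling in
  \<open>lf_xi\<close>.\<close>

lemma weighted_sum_le_lf_xi:
  fixes Y :: "complex ^ ('n::finite) option ^ 'n option"
  defines "w \<equiv> zero_load_voltage Y"
  assumes w: "\<And>j. w $ j \<noteq> 0" and b: "\<And>j. cmod (b j) \<le> \<beta> / cmod (w $ j)"
  shows "cmod (\<Sum>j\<in>UNIV. matrix_inv (Y_LL Y) $ i $ j * (cnj (s $ j) * b j))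
    \<le> \<beta> * lf_xi Y s * cmod (w $ i)"
proof -
  have "0 \<le> \<beta> / cmod (w $ i)"
    using b[of i] by (meson norm_ge_zero order_trans)
  then have "\<beta> \<ge> 0"
    using w[of i] by (simp add: zero_le_divide_iff)
  have "cmod (\<Sum>j\<in>UNIV. matrix_inv (Y_LL Y) $ i $ j * (cnj (s $ j) * b j))
      \<le> (\<Sum>j\<in>UNIV. cmod (matrix_inv (Y_LL Y) $ i $ j) * cmod (s $ j) * cmod (b j))"
    by (rule order_trans[OF norm_sum]) (simp add: norm_mult mult.assoc)
  also have "\<dots> \<le> (\<Sum>j\<in>UNIV. cmod (matrix_inv (Y_LL Y) $ i $ j) * cmod (s $ j)
      * (\<beta> / cmod (w $ j)))"
    by (intro sum_mono mult_left_mono b) auto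
  also have "\<dots> = \<beta> * (\<Sum>j\<in>UNIV. cmod (matrix_inv (Y_LL Y) $ i $ j) * cmod (s $ j)
      / cmod (w $ j))"
    by (simp add: sum_distrib_left mult_ac)
  also have "\<dots> \<le> \<beta> * (lf_xi Y s * cmod (w $ i))"
    using row_sum_le_lf_xi[of Y i s] w \<open>\<beta> \<ge> 0\<close> unfolding w_def
    by (intro mult_left_mono) auto
  finally show ?thesis by (simp add: mult.assoc)
qed

lemma inverse_cnj_bound:
  fixes x :: complex
  assumes "\<alpha> > 0" "c > 0" "\<alpha> * c \<le> cmod x"
  shows "cmod (inverse (cnj x)) \<le> 1 / \<alpha> / c"
proof -
  have "inverse (cmod x) \<le> inverse (\<alpha> * c)"
    using assms by (intro le_imp_inverse_le) auto
  then show ?thesis by (simp add: norm_inverse divide_inverse)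
qed

text \<open>Over the common denominator, one of the two factors \<open>c\<close> cancels against
  \<open>r * c\<close>. Separate \<alpha> and \<beta> let one point be \<open>v_hat\<close>, which
  has a better lower bound than a general point of \<open>D\<close>.\<close>

lemma inverse_cnj_diff_bound:
  fixes x y :: complex
  assumes "\<alpha> > 0" "\<beta> > 0" "c > 0" "\<alpha> * c \<le> cmod x" "\<beta> * c \<le> cmod y"
    and "cmod (x - y) \<le> r * c"
  shows "cmod (inverse (cnj x) - inverse (cnj y)) \<le> r / (\<alpha> * \<beta>) / c"
proof -
  have pos: "0 < \<alpha> * c" "0 < \<beta> * c" using assms by auto
  then have nz: "x \<noteq> 0" "y \<noteq> 0" using assms(4,5) by auto
  have "cmod (inverse (cnj x) - inverse (cnj y)) = cmod (x - y) / (cmod x * cmod y)"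
  proof -
    have "inverse (cnj x) - inverse (cnj y) = cnj (y - x) / (cnj x * cnj y)"
      using nz by (simp add: field_simps)
    then show ?thesis
      by (simp only: norm_divide norm_mult complex_mod_cnj norm_minus_commute)
  qed
  also have "\<dots> \<le> (r * c) / ((\<alpha> * c) * (\<beta> * c))"
    using pos assms order_trans[OF norm_ge_zero assms(6)]
    by (intro frac_le mult_mono) auto
  also have "\<dots> = r / (\<alpha> * \<beta>) / c"
    using assms by (simp add: field_simps)
  finally show ?thesis .
qed

section \<open>Sensitivity of the load-flow map to injections and voltages\<close>

lemma lf_step_power_diff_bound:
  fixes Y :: "complex ^ ('n::finite) option ^ 'n option"
  defines "w \<equiv> zero_load_voltage Y"
  assumes w: "\<And>j. w $ j \<noteq> 0" and \<alpha>: "\<alpha> > 0" and x: "\<And>j. \<alpha> * cmod (w $ j) \<le> cmod (x $ j)"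
  shows "cmod (lf_step Y s x $ i - lf_step Y t x $ i) \<le> lf_xi Y (s - t) / \<alpha> * cmod (w $ i)"
proof -
  have nz: "x $ j \<noteq> 0" for j
    using x[of j] \<alpha> w[of j] by (auto simp: mult_le_0_iff)
  have "lf_step Y s x $ i - lf_step Y t x $ i = (\<Sum>j\<in>UNIV. matrix_inv (Y_LL Y) $ i $ j
      * (cnj ((s - t) $ j) * inverse (cnj (x $ j))))"
    by (simp add: lf_step_nth nz algebra_simps flip: sum_subtractf)
  also have "cmod \<dots> \<le> 1 / \<alpha> * lf_xi Y (s - t) * cmod (w $ i)"
    unfolding w_def using w x \<alpha>
    by (intro weighted_sum_le_lf_xi inverse_cnj_bound) (auto simp: w_def)
  finally show ?thesis by simp
qed

text \<open>Used twice: with \<beta> = \<open>u_min\<close> to compare with \<open>v_hat\<close>,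
  and with \<beta> = \<alpha> for the Lipschitz constant on \<open>D\<close>.\<close>

lemma lf_step_voltage_diff_bound:
  fixes Y :: "complex ^ ('n::finite) option ^ 'n option"
  defines "w \<equiv> zero_load_voltage Y"
  assumes w: "\<And>j. w $ j \<noteq> 0" and pos: "\<alpha> > 0" "\<beta> > 0"
    and x: "\<And>j. \<alpha> * cmod (w $ j) \<le> cmod (x $ j)"
    and y: "\<And>j. \<beta> * cmod (w $ j) \<le> cmod (y $ j)"
    and xy: "\<And>j. cmod (x $ j - y $ j) \<le> r * cmod (w $ j)"
  shows "cmod (lf_step Y s x $ i - lf_step Y s y $ i)
    \<le> r / (\<alpha> * \<beta>) * lf_xi Y s * cmod (w $ i)"
proof -
  have nz: "x $ j \<noteq> 0" "y $ j \<noteq> 0" for j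
    using x[of j] y[of j] pos w[of j] by (auto simp: mult_le_0_iff)
  have "lf_step Y s x $ i - lf_step Y s y $ i = (\<Sum>j\<in>UNIV. matrix_inv (Y_LL Y) $ i $ j
      * (cnj (s $ j) * (inverse (cnj (x $ j)) - inverse (cnj (y $ j)))))"
    by (simp add: lf_step_nth nz algebra_simps flip: sum_subtractf)
  also have "cmod \<dots> \<le> r / (\<alpha> * \<beta>) * lf_xi Y s * cmod (w $ i)"
    unfolding w_def using w x y xy pos
    by (intro weighted_sum_le_lf_xi inverse_cnj_diff_bound) (auto simp: w_def)
  finally show ?thesis .
qed

text \<open>The injections enter additively through the last diagonal factor, so each row sum obeys
  the triangle inequality. This bounds \<open>lf_xi Y s\<close> in the Lipschitz constant.\<close>

lemma lf_xi_triangle: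
  fixes Y :: "complex ^ ('n::finite) option ^ 'n option"
  shows "lf_xi Y s \<le> lf_xi Y t + lf_xi Y (s - t)"
proof -
  have entry: "(M ** diag_mat (cnj_vec s)) $ i $ j
      = (M ** diag_mat (cnj_vec t)) $ i $ j + (M ** diag_mat (cnj_vec (s - t))) $ i $ j"
    for M :: "complex ^ 'n ^ 'n" and i j
    by (simp add: matrix_mul_diag_mat cnj_vec_def algebra_simps)
  have "mat_norm_inf (M ** diag_mat (cnj_vec s)) \<le> mat_norm_inf (M ** diag_mat (cnj_vec t))
      + mat_norm_inf (M ** diag_mat (cnj_vec (s - t)))" for M :: "complex ^ 'n ^ 'n"
  proof -
    have "(\<Sum>j\<in>UNIV. cmod ((M ** diag_mat (cnj_vec s)) $ i $ j))
        \<le> mat_norm_inf (M ** diag_mat (cnj_vec t))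
          + mat_norm_inf (M ** diag_mat (cnj_vec (s - t)))" for i
    proof -
      have "(\<Sum>j\<in>UNIV. cmod ((M ** diag_mat (cnj_vec s)) $ i $ j))
          \<le> (\<Sum>j\<in>UNIV. cmod ((M ** diag_mat (cnj_vec t)) $ i $ j))
            + (\<Sum>j\<in>UNIV. cmod ((M ** diag_mat (cnj_vec (s - t))) $ i $ j))"
        unfolding entry sum.distrib[symmetric] by (intro sum_mono norm_triangle_ineq)
      also have "\<dots> \<le> mat_norm_inf (M ** diag_mat (cnj_vec t))
          + mat_norm_inf (M ** diag_mat (cnj_vec (s - t)))"
        by (intro add_mono row_sum_le_mat_norm_inf)
      finally show ?thesis .
    qed
    then show ?thesis
      unfolding mat_norm_inf_def[of "M ** diag_mat (cnj_vec s)"] by (intro Max.boundedI) auto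
  qed
  then show ?thesis by (simp add: lf_xi_def Let_def)
qed

section \<open>Self-mapping and contraction on \<open>D\<close>\<close>

theorem theorem1:
  fixes Y :: "complex ^ ('n::finite) option ^ 'n option"
    and w v_hat s_hat s :: "complex ^ 'n"
    and u_min \<Delta> \<rho> :: real
    and D :: "(complex ^ 'n) set"
  assumes "invertible (Y_LL Y)"
    and "w = zero_load_voltage Y"
    and "\<forall>j. w $ j \<noteq> 0"
    and "lf_solution Y v_hat s_hat"
    and "u_min = (MIN j. cmod (v_hat $ j / w $ j))"
    and "lf_xi Y s_hat < u_min ^ 2"
    and "\<Delta> = (u_min - lf_xi Y s_hat / u_min) ^ 2 - 4 * lf_xi Y (s - s_hat)"
    and "\<Delta> > 0"
    and "\<rho> = ((u_min - lf_xi Y s_hat / u_min) - sqrt \<Delta>) / 2"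
    and "D = {v. \<forall>i. cmod (v $ i - v_hat $ i) \<le> \<rho> * cmod (w $ i)}"
  shows "(\<exists>!v. v \<in> D \<and> lf_solution Y v s) \<and>
    (\<forall>v. v \<in> D \<and> lf_solution Y v s \<longrightarrow>
      (\<forall>v0\<in>D. (\<forall>k j. ((lf_step Y s ^^ k) v0) $ j \<noteq> 0) \<and>
        (\<lambda>k. (lf_step Y s ^^ k) v0) \<longlonglongrightarrow> v))"
proof -
  define \<xi> where "\<xi> = lf_xi Y s_hat"
  define \<delta> where "\<delta> = lf_xi Y (s - s_hat)"
  define a where "a = u_min - \<xi> / u_min"
  have xi0: "\<xi> \<ge> 0" "\<delta> \<ge> 0" "lf_xi Y s \<ge> 0"
    by (simp_all add: \<xi>_def \<delta>_def lf_xi_nonneg)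
  have w: "w $ j \<noteq> 0" "zero_load_voltage Y $ j \<noteq> 0" for j using assms(2,3) by auto
  have v_hat: "v_hat $ j \<noteq> 0" "v_hat = lf_step Y s_hat v_hat" for j
    using assms(4) by (auto simp: lf_solution_def)
  have u: "u_min > 0"
    unfolding assms(5) using v_hat(1) w by (subst Min_gr_iff) auto
  have u_le: "u_min * cmod (w $ j) \<le> cmod (v_hat $ j)" for j
  proof -
    have "u_min \<le> cmod (v_hat $ j / w $ j)"
      unfolding assms(5) by (rule Min_le) auto
    then show ?thesis using w(1)[of j] by (simp add: norm_divide pos_le_divide_eq)
  qed
  \<comment> \<open>Together with \<open>\<delta>_eq\<close> below, this expresses both loads
    through \<open>u_min\<close>, \<open>a\<close> and \<rho>, so the later identities become
    polynomial.\<close>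
  have xi_eq: "\<xi> = u_min * (u_min - a)" using u by (simp add: a_def field_simps)
  have a_pos: "a > 0"
    using assms(6) u by (simp add: a_def \<xi>_def power2_eq_square field_simps)
  have a_le: "a \<le> u_min" using u xi0 by (simp add: a_def)
  have \<Delta>: "\<Delta> = a\<^sup>2 - 4 * \<delta>" and \<rho>: "\<rho> = (a - sqrt \<Delta>) / 2"
    by (simp_all add: assms(7,9) a_def \<xi>_def \<delta>_def)
  have sq: "sqrt \<Delta> = a - 2 * \<rho>" using \<rho> by simp
  have \<rho>_less: "2 * \<rho> < a" using sq assms(8) by (metis diff_gt_0_iff_gt real_sqrt_gt_zero)
  \<comment> \<open>Nonnegativity of \<rho> is what places \<open>v_hat\<close> in
    \<open>D\<close>.\<close>
  have "sqrt \<Delta> \<le> sqrt (a\<^sup>2)" using \<Delta> xi0 by (intro real_sqrt_le_mono) auto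
  then have \<rho>0: "\<rho> \<ge> 0" using a_pos sq by simp
  have "\<Delta> = (a - 2 * \<rho>)\<^sup>2" using assms(8) by (simp flip: sq)
  then have \<delta>_eq: "\<delta> = \<rho> * (a - \<rho>)" using \<Delta> by (simp add: power2_eq_square algebra_simps)
  define \<alpha> where "\<alpha> = u_min - \<rho>"
  have \<alpha>: "\<alpha> > 0" using a_le \<rho>_less \<rho>0 u by (simp add: \<alpha>_def)
  have lower: "\<alpha> * cmod (w $ j) \<le> cmod (v $ j)" if "v \<in> D" for v j
  proof -
    have "cmod (v_hat $ j) \<le> cmod (v $ j) + cmod (v $ j - v_hat $ j)"
      using norm_triangle_sub norm_minus_commute by metis
    moreover have "cmod (v $ j - v_hat $ j) \<le> \<rho> * cmod (w $ j)" using that assms(10) by auto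
    ultimately show ?thesis using u_le[of j] by (simp add: \<alpha>_def left_diff_distrib)
  qed
  have nz: "v $ j \<noteq> 0" if "v \<in> D" for v j
    using lower[OF that, of j] \<alpha> w(1)[of j] by (auto simp: mult_le_0_iff)
  have self: "lf_step Y s v \<in> D" if v: "v \<in> D" for v
  proof -
    have "cmod (lf_step Y s v $ i - v_hat $ i) \<le> \<rho> * cmod (w $ i)" for i
    proof -
      \<comment> \<open>The intermediate point \<open>lf_step Y s_hat v\<close> separates the change
        of injection from the change of voltage; \<open>v_hat\<close> is its own image under
        \<open>lf_step Y s_hat\<close>.\<close>
      have "cmod (lf_step Y s v $ i - lf_step Y s_hat v $ i) \<le> \<delta> / \<alpha> * cmod (w $ i)"
        unfolding \<delta>_def assms(2)
        by (rule lf_step_power_diff_bound) (use w lower[OF v] \<alpha> assms(2) in auto)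
      moreover have "cmod (lf_step Y s_hat v $ i - lf_step Y s_hat v_hat $ i)
          \<le> \<rho> / (\<alpha> * u_min) * \<xi> * cmod (w $ i)"
        unfolding \<xi>_def assms(2)
        by (rule lf_step_voltage_diff_bound)
          (use w lower[OF v] u_le \<alpha> u v assms(2,10) in auto)
      \<comment> \<open>Equality, because \<rho> is exactly a root of the quadratic.\<close>
      moreover have "\<delta> / \<alpha> + \<rho> / (\<alpha> * u_min) * \<xi> = \<rho>"
      proof -
        have "\<delta> / \<alpha> + \<rho> / (\<alpha> * u_min) * \<xi> = (\<rho> * (a - \<rho>) + \<rho> * (u_min - a)) / \<alpha>"
          unfolding \<delta>_eq xi_eq using u \<alpha> by (simp add: field_simps)
        also have "\<dots> = \<rho> * \<alpha> / \<alpha>" by (simp add: \<alpha>_def algebra_simps)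
        finally show ?thesis using \<alpha> by simp
      qed
      ultimately have "cmod (lf_step Y s v $ i - lf_step Y s_hat v $ i)
          + cmod (lf_step Y s_hat v $ i - lf_step Y s_hat v_hat $ i) \<le> \<rho> * cmod (w $ i)"
        by (metis add_mono distrib_right)
      then have "cmod (lf_step Y s v $ i - lf_step Y s_hat v_hat $ i) \<le> \<rho> * cmod (w $ i)"
        using norm_triangle_ineq[of "lf_step Y s v $ i - lf_step Y s_hat v $ i"
            "lf_step Y s_hat v $ i - lf_step Y s_hat v_hat $ i"] by simp
      then show ?thesis using v_hat(2) by simp
    qed
    then show ?thesis unfolding assms(10) by simp
  qed
  define q where "q = lf_xi Y s / \<alpha>\<^sup>2"
  have q: "0 \<le> q" "q < 1"
  proof -
    have "lf_xi Y s \<le> \<xi> + \<delta>"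
      unfolding \<xi>_def \<delta>_def by (rule lf_xi_triangle)
    also have "\<xi> + \<delta> = \<alpha>\<^sup>2 - \<alpha> * (a - 2 * \<rho>)"
      unfolding \<delta>_eq xi_eq \<alpha>_def by (simp add: power2_eq_square algebra_simps)
    also have "\<dots> < \<alpha>\<^sup>2" using \<alpha> \<rho>_less by simp
    finally show "q < 1" using \<alpha> by (simp add: q_def)
    show "0 \<le> q" using xi0 by (simp add: q_def)
  qed
  have "closed D"
    unfolding assms(10) by (intro closed_Collect_all closed_Collect_le continuous_intros)
  have "v_hat \<in> D" using \<rho>0 assms(10) by simp
  have contr: "cmod (lf_step Y s x $ i - lf_step Y s y $ i) \<le> q * r * cmod (w $ i)"
    if "x \<in> D" "y \<in> D" "\<And>j. cmod (x $ j - y $ j) \<le> r * cmod (w $ j)" for x y r i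
  proof -
    have "cmod (lf_step Y s x $ i - lf_step Y s y $ i)
        \<le> r / (\<alpha> * \<alpha>) * lf_xi Y s * cmod (zero_load_voltage Y $ i)"
      by (rule lf_step_voltage_diff_bound)
        (use w \<alpha> lower[OF that(1)] lower[OF that(2)] that(3) assms(2) in auto)
    then show ?thesis by (simp add: q_def assms(2) power2_eq_square mult_ac)
  qed
  \<comment> \<open>On \<open>D\<close> no voltage vanishes, so solutions are precisely fixed
    points.\<close>
  have sol: "v \<in> D \<and> lf_solution Y v s \<longleftrightarrow> v \<in> D \<and> lf_step Y s v = v" for v
    using nz by (auto simp: lf_solution_def)
  \<comment> \<open>Staying in \<open>D\<close> keeps all iterates free of zero entries, so every
    \<open>matrix_inv\<close> in the iteration is a genuine inverse.\<close>
  have iter: "(lf_step Y s ^^ k) v \<in> D" if "v \<in> D" for k v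
    using that by (induction k) (auto intro: self)
  note banach = weighted_max_contraction[where f = "lf_step Y s" and D = D
      and c = "\<lambda>i. cmod (w $ i)" and q = q]
  have "\<exists>!v. v \<in> D \<and> lf_step Y s v = v"
    by (rule banach(1)) (use \<open>closed D\<close> \<open>v_hat \<in> D\<close> self w q contr in auto)
  moreover have "(\<lambda>k. (lf_step Y s ^^ k) v0) \<longlonglongrightarrow> v"
    if "v \<in> D" "lf_step Y s v = v" "v0 \<in> D" for v v0
    by (rule banach(2)) (use \<open>closed D\<close> \<open>v_hat \<in> D\<close> self w q contr that in auto)
  ultimately show ?thesis
    unfolding sol using iter nz by blast
qed

end
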